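(* Let $P\subset\mathbb{R}^d$ be a full-dimensional simple polytope with $n$ facets, let $U\in\mathbb{R}^{n\times d}$ be a ray matrix of its normal fan, and let $\Delta\subseteq P$ be a face of codimension $k$. The restriction of ${\rm Adj}_{P,U}(x)$ to the coordinate subspace $\Lambda_\Delta$ equals $$({\rm Adj}_{P,U})_{|\Lambda_\Delta}=c_\Delta^{-1}\cdot\Big(\prod_{Q\cap\Delta=\emptyset}x_Q\Big)\cdot{\rm Adj}_{\Delta,U_\Delta}.$$ Moreover, ${\rm res}_{\Lambda_\Delta}{\rm Amp}_{P,U}=c_\Delta^{-1}\cdot{\rm Amp}_{\Delta,U_\Delta}$.
   Context: The inner normal fan $\Sigma_P$ of $P$ is simplicial; its rays are identified with the facets $Q$ of $P$. A ray matrix $U$ has rows $u_Q$ indexed by facets, with $u_Q$ a nonzero generator of the corresponding ray (an inner normal vector of $Q$). For a simplicial fan $\Sigma$ in $\mathbb{R}^m$ with ray matrix $W$ (and $\Sigma(m)$ the set of its $m$-dimensional cones, $\sigma(1)$ the rays of $\sigma$, $W_\sigma$ the submatrix of $W$ with rows indexed by $\sigma(1)$), $${\rm Amp}_{\Sigma,W}=\sum_{\sigma\in\Sigma(m)}\frac{|\det W_\sigma|}{\prod_{\rho\in\sigma(1)}x_\rho},\qquad{\rm Adj}_{\Sigma,W}=\sum_{\sigma\in\Sigma(m)}|\det W_\sigma|\prod_{\rho\notin\sigma(1)}x_\rho,$$ (empty determinants and products are $1$). ${\rm Amp}_{P,U}={\rm Amp}_{\Sigma_P,U}$, ${\rm Adj}_{P,U}={\rm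 Adj}_{\Sigma_P,U}$, with variables $x_Q$. $\Lambda_\Delta=\{x\in\mathbb{P}^{n-1}:x_Q=0\text{ for all facets }Q\supseteq\Delta\}$; restriction means setting these $x_Q$ to $0$. For a rational function $f$ with poles of order at most one along the coordinate hyperplanes, ${\rm res}_{\Lambda_\Delta}f=\big((\prod_{Q\supseteq\Delta}x_Q)\cdot f\big)_{|\Lambda_\Delta}$. Let $T_\Delta\in\mathbb{R}^{d\times d}$ be an invertible matrix such that the rows of $U\cdot T_\Delta$ indexed by the $k$ facets of $P$ containing $\Delta$ are the standard basis vectors $e_1,\dots,e_k$, and $c_\Delta=|\det T_\Delta|$. $U_\Delta$ consists of the last $d-k$ columns of $U\cdot T_\Delta$ and the rows indexed by facets $Q$ for which $Q\cap\Delta$ is a facet of $\Delta$ (nonempty; $U_\Delta$ has no rows if $\Delta$ is a vertex). The rows of $U_\Delta$ generate the rays of the normal fan $\Sigma_\Delta$ of $\Delta$ in $\mathbb{R}^{d-k}$, in the coordinates defined by $T_\Delta$; the variable of the facet $Q\cap\Delta$ of $\Delta$ is identified with $x_Q$. ${\rm Adj}_{\Delta,U_\Delta}={\rm Adj}_{\Sigma_\Delta,U_\Delta}$ and ${\rm Amp}_{\Delta,U_\Delta}={\rm Amp}_{\Sigma_\Delta,U_\Delta}$. The product in the claim is over facets $Q$ of $P$. *)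

theory Defs
  imports
    "HOL-Analysis.Analysis"
    "HOL-Library.Poly_Mapping"
    "HOL-Computational_Algebra.Polynomial_Factorial"
begin

section \<open>Polynomials and rational functions in the variables \<open>x\<^sub>i\<close>\<close>

text \<open>The monomial with exponents \<open>m\<close> is the finitely supported map \<open>m\<close>; a polynomial maps
  monomials to coefficients. The linear order on the variables plays no mathematical role: the
  library needs it to know that the polynomials form an integral domain.\<close>

type_synonym 'n mpoly = "('n \<Rightarrow>\<^sub>0 nat) \<Rightarrow>\<^sub>0 real"

type_synonym 'n ratfun = "'n mpoly fract"

definition Const :: "real \<Rightarrow> 'n mpoly" where
  "Const c = Poly_Mapping.single 0 c"

definition Var :: "'n \<Rightarrow> 'n mpoly" where
  "Var i = Poly_Mapping.single (Poly_Mapping.single i 1) 1"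

definition subst_poly :: "('n \<Rightarrow> 'n mpoly) \<Rightarrow> 'n mpoly \<Rightarrow> 'n mpoly" where
  "subst_poly s p =
     (\<Sum>m \<in> Poly_Mapping.keys p. Const (Poly_Mapping.lookup p m) *
        (\<Prod>i \<in> Poly_Mapping.keys m. s i ^ Poly_Mapping.lookup m i))"

text \<open>Restriction to the coordinate subspace \<open>x\<^sub>i = 0\<close> (\<open>i \<in> S\<close>).\<close>

definition restrict_poly :: "'n set \<Rightarrow> 'n mpoly \<Rightarrow> 'n mpoly" where
  "restrict_poly S = subst_poly (\<lambda>i. if i \<in> S then 0 else Var i)"

text \<open>A rational function is restricted by writing it as \<open>p / q\<close> with \<open>q\<close> not vanishing
  identically on the subspace; the result does not depend on the choice of \<open>p\<close> and \<open>q\<close>. It is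
  unspecified if there is no such representation.\<close>

definition restrict_ratfun :: "'n::linorder set \<Rightarrow> 'n ratfun \<Rightarrow> 'n ratfun" where
  "restrict_ratfun S f =
     (THE g. \<exists>p q. restrict_poly S q \<noteq> 0 \<and> f = Fract p q \<and>
        g = Fract (restrict_poly S p) (restrict_poly S q))"

definition res :: "'n::linorder set \<Rightarrow> 'n ratfun \<Rightarrow> 'n ratfun" where
  "res S f = restrict_ratfun S (to_fract (\<Prod>i\<in>S. Var i) * f)"


section \<open>Coordinate spaces\<close>

text \<open>Both \<open>\<real>\<^sup>d\<close> and \<open>\<real>\<^bsup>d-k\<^esup>\<close> are needed, including \<open>\<real>\<^sup>0\<close>, which is not of the form \<open>real ^ 'm\<close>.
  So \<open>\<real>\<^sup>J\<close>, for a set \<open>J :: 'd set\<close> of coordinates, is the subspace of \<open>real ^ 'd\<close> of the vectors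
  supported on \<open>J\<close>.\<close>

definition coord_space :: "'d set \<Rightarrow> (real ^ 'd) set" where
  "coord_space J = {v. \<forall>i. i \<notin> J \<longrightarrow> v $ i = 0}"

definition coord_proj :: "'d set \<Rightarrow> real ^ 'd \<Rightarrow> real ^ 'd" where
  "coord_proj J v = (\<chi> i. if i \<in> J then v $ i else 0)"

text \<open>The Leibniz formula for a matrix with rows and columns indexed by \<open>J\<close>; it is literally
  the library's \<open>det\<close> if \<open>J = UNIV\<close>, and it is \<open>1\<close> if \<open>J = {}\<close>.\<close>

definition det_on :: "'d set \<Rightarrow> ('d \<Rightarrow> real ^ 'd) \<Rightarrow> real" where
  "det_on J A = (\<Sum>p | p permutes J. of_int (sign p) * (\<Prod>i\<in>J. A i $ p i))"

text \<open>\<open>\<bar>det W\<^sub>R\<bar>\<close> for the square submatrix of \<open>W\<close> with rows \<open>R\<close> and columns \<open>J\<close>, where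
  \<open>card R = card J\<close>. Reordering the rows only changes the sign of the determinant, so the
  choice of the bijection is irrelevant.\<close>

definition abs_minor :: "'d set \<Rightarrow> real ^ 'd ^ 'n \<Rightarrow> 'n set \<Rightarrow> real" where
  "abs_minor J W R = \<bar>det_on J (\<lambda>j. W $ (SOME f. bij_betw f J R) j)\<bar>"


section \<open>Polytopes and normal fans\<close>

definition simple_polytope :: "(real ^ 'd) set \<Rightarrow> bool" where
  "simple_polytope P \<longleftrightarrow> polytope P \<and>
     (\<forall>v. v extreme_point_of P \<longrightarrow> int (card {F. F facet_of P \<and> v \<in> F}) = aff_dim P)"

text \<open>The inner normal cone of the face \<open>F\<close> and the inner normal fan, for a polytope
  \<open>P \<subseteq> \<real>\<^sup>J\<close>, taken in \<open>\<real>\<^sup>J\<close>.\<close>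

definition normal_cone :: "'d set \<Rightarrow> (real ^ 'd) set \<Rightarrow> (real ^ 'd) set \<Rightarrow> (real ^ 'd) set" where
  "normal_cone J P F = {u \<in> coord_space J. \<forall>x\<in>F. \<forall>y\<in>P. u \<bullet> x \<le> u \<bullet> y}"

definition normal_fan :: "'d set \<Rightarrow> (real ^ 'd) set \<Rightarrow> (real ^ 'd) set set" where
  "normal_fan J P = {normal_cone J P F | F. F face_of P \<and> F \<noteq> {}}"

text \<open>The facets of \<open>P\<close> are numbered by \<open>facet\<close>; row \<open>i\<close> generates the ray of the facet \<open>facet i\<close>.\<close>

definition is_ray_matrix ::
    "(real ^ 'd) set \<Rightarrow> ('n \<Rightarrow> (real ^ 'd) set) \<Rightarrow> real ^ 'd ^ 'n \<Rightarrow> bool" where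
  "is_ray_matrix P facet U \<longleftrightarrow>
     (\<forall>i. U $ i \<noteq> 0 \<and> conic hull {U $ i} = normal_cone UNIV P (facet i))"


section \<open>Amplitude and adjoint of a simplicial fan\<close>

text \<open>In this section \<open>\<Sigma>\<close> is a simplicial fan in \<open>\<real>\<^sup>J\<close> whose rays are generated by the rows
  \<open>W $ i\<close>, \<open>i \<in> I\<close>. So a ray is identified with its index in \<open>I\<close>, and the rows of \<open>W\<close> outside \<open>I\<close>
  are ignored (a ray matrix may have no rows).\<close>

definition max_cones :: "'d set \<Rightarrow> (real ^ 'd) set set \<Rightarrow> (real ^ 'd) set set" where
  "max_cones J \<Sigma> = {\<sigma> \<in> \<Sigma>. dim \<sigma> = card J}"

definition cone_rays :: "'n set \<Rightarrow> real ^ 'd ^ 'n \<Rightarrow> (real ^ 'd) set \<Rightarrow> 'n set" where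
  "cone_rays I W \<sigma> = {i \<in> I. (conic hull {W $ i}) face_of \<sigma>}"

definition Amp ::
    "'d set \<Rightarrow> (real ^ 'd) set set \<Rightarrow> 'n set \<Rightarrow>
      real ^ 'd ^ ('n::{finite,linorder}) \<Rightarrow> 'n ratfun" where
  "Amp J \<Sigma> I W =
     (\<Sum>\<sigma> \<in> max_cones J \<Sigma>.
        to_fract (Const (abs_minor J W (cone_rays I W \<sigma>))) /
        to_fract (\<Prod>i \<in> cone_rays I W \<sigma>. Var i))"

definition Adj ::
    "'d set \<Rightarrow> (real ^ 'd) set set \<Rightarrow> 'n set \<Rightarrow> real ^ 'd ^ 'n \<Rightarrow> 'n mpoly" where
  "Adj J \<Sigma> I W =
     (\<Sum>\<sigma> \<in> max_cones J \<Sigma>.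
        Const (abs_minor J W (cone_rays I W \<sigma>)) *
        (\<Prod>i \<in> I - cone_rays I W \<sigma>. Var i))"


section \<open>The fan and the ray matrix of a face\<close>

text \<open>Covectors transform by \<open>u \<mapsto> u v* T\<close>, hence points by \<open>x \<mapsto> matrix_inv T *v x\<close>. If the rows of
  \<open>U ** T\<close> for the facets containing \<open>D\<close> are the basis vectors with index in \<open>K\<close>, the coordinates
  in \<open>K\<close> are constant on the image of \<open>D\<close>; dropping them yields a full-dimensional polytope in
  \<open>\<real>\<^sup>J\<close>, where \<open>J = - K\<close>.\<close>

definition face_in_coords ::
    "real ^ 'd ^ 'd \<Rightarrow> 'd set \<Rightarrow> (real ^ 'd) set \<Rightarrow> (real ^ 'd) set" where
  "face_in_coords T J D = (\<lambda>x. coord_proj J (matrix_inv T *v x)) ` D"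

definition face_fan ::
    "real ^ 'd ^ 'd \<Rightarrow> 'd set \<Rightarrow> (real ^ 'd) set \<Rightarrow> (real ^ 'd) set set" where
  "face_fan T J D = normal_fan J (face_in_coords T J D)"

definition face_rows :: "('n \<Rightarrow> (real ^ 'd) set) \<Rightarrow> (real ^ 'd) set \<Rightarrow> 'n set" where
  "face_rows facet D = {i. (facet i \<inter> D) facet_of D}"

text \<open>\<open>U\<^sub>\<Delta>\<close> is this matrix with its rows taken from \<open>face_rows facet D\<close> only.\<close>

definition face_matrix ::
    "real ^ 'd ^ 'n \<Rightarrow> real ^ 'd ^ 'd \<Rightarrow> 'd set \<Rightarrow> real ^ 'd ^ 'n" where
  "face_matrix U T J = (\<chi> i. coord_proj J ((U ** T) $ i))"

end

theory Submission
  imports Defs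
begin

text \<open>Near a vertex \<open>v\<close> the simple polytope \<open>P = {x. b\<^sub>i \<le> u\<^sub>i \<bullet> x}\<close> is a simplicial cone, so the rows
  \<open>u\<^sub>i\<close> tight at \<open>v\<close> are a basis and generate the normal cone of \<open>v\<close>; the dual basis consists of the
  edge directions at \<open>v\<close>. Thus the adjoint is a sum over the vertices. Setting \<open>x\<^sub>Q = 0\<close> for
  \<open>Q \<supseteq> \<Delta>\<close> keeps exactly the terms of the vertices of \<open>\<Delta>\<close>, and for these the block form
  of \<open>U T\<close> turns the minors of \<open>U\<close> into those of \<open>U\<^sub>\<Delta>\<close>. The amplitude is the adjoint divided by
  the product of all variables, so its residue follows from the restriction of the adjoint.\<close>

section \<open>Substitution in polynomials and rational functions\<close>

lemma Const_0 [simp]: "Const 0 = 0" and Const_1 [simp]: "Const 1 = 1"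
  by (simp_all add: Const_def)

lemma Const_add: "Const (a + b) = Const a + Const b"
  by (simp add: Const_def single_add)

lemma Const_mult: "Const (a * b) = Const a * Const b"
  by (simp add: Const_def mult_single)

lemma poly_mapping_sum_single:
  "(\<Sum>m\<in>Poly_Mapping.keys p. Poly_Mapping.single m (Poly_Mapping.lookup p m)) = p"
  by (rule poly_mapping_eqI)
    (simp add: lookup_sum lookup_single when_def in_keys_iff)

text \<open>Coefficients outside the support are 0, so several polynomials can be summed over one
  common index set. Additivity needs this, as the support of a sum may shrink by
  cancellation.\<close>

lemma subst_poly_superset:
  assumes "finite M" "Poly_Mapping.keys p \<subseteq> M"
  shows "subst_poly s p = (\<Sum>m\<in>M. Const (Poly_Mapping.lookup p m) *
           (\<Prod>i\<in>Poly_Mapping.keys m. s i ^ Poly_Mapping.lookup m i))"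
  unfolding subst_poly_def
  by (rule sum.mono_neutral_left) (use assms in \<open>auto simp: in_keys_iff\<close>)

lemma subst_poly_0 [simp]: "subst_poly s 0 = 0"
  by (simp add: subst_poly_def)

lemma subst_poly_add: "subst_poly s (p + q) = subst_poly s p + subst_poly s q"
  using keys_add[of p q]
  by (simp add: subst_poly_superset[of "Poly_Mapping.keys p \<union> Poly_Mapping.keys q"]
      lookup_add Const_add algebra_simps sum.distrib)

lemma subst_poly_sum: "subst_poly s (\<Sum>i\<in>A. f i) = (\<Sum>i\<in>A. subst_poly s (f i))"
  by (induction A rule: infinite_finite_induct) (simp_all add: subst_poly_add)

text \<open>An absent variable contributes \<open>s i ^ 0 = 1\<close>, so the product may run over
  all of the finitely many variables. Products of monomials can then be compared factor by
  factor.\<close>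

lemma subst_poly_single:
  "subst_poly s (Poly_Mapping.single m c) =
     Const c * (\<Prod>i\<in>UNIV. s i ^ Poly_Mapping.lookup m i)" for m :: "'n::finite \<Rightarrow>\<^sub>0 nat"
proof -
  have "(\<Prod>i\<in>Poly_Mapping.keys m. s i ^ Poly_Mapping.lookup m i) =
      (\<Prod>i\<in>UNIV. s i ^ Poly_Mapping.lookup m i)"
    by (rule prod.mono_neutral_left) (auto simp: in_keys_iff)
  then show ?thesis
    by (simp add: subst_poly_superset[of "{m}"])
qed

lemma subst_poly_mult: "subst_poly s (p * q) = subst_poly s p * subst_poly s q"
  for p :: "'n::finite mpoly"
proof -
  let ?t = "\<lambda>p m. Poly_Mapping.single m (Poly_Mapping.lookup p m)"
  have single: "subst_poly s (?t p m * ?t q m') = subst_poly s (?t p m) * subst_poly s (?t q m')"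
    for m m'
    by (simp add: mult_single subst_poly_single lookup_add Const_mult power_add prod.distrib ac_simps)
  have "subst_poly s (sum (?t p) (Poly_Mapping.keys p) * sum (?t q) (Poly_Mapping.keys q)) =
      subst_poly s (sum (?t p) (Poly_Mapping.keys p)) * subst_poly s (sum (?t q) (Poly_Mapping.keys q))"
    by (simp add: sum_product subst_poly_sum single)
  then show ?thesis
    by (simp add: poly_mapping_sum_single)
qed

lemma subst_poly_Const: "subst_poly s (Const c) = Const c" for s :: "'n::finite \<Rightarrow> 'n mpoly"
proof -
  have "subst_poly s (Poly_Mapping.single 0 c) = Const c"
    by (simp add: subst_poly_single)
  then show ?thesis
    by (simp only: Const_def)
qed

lemma subst_poly_1 [simp]: "subst_poly s 1 = 1" for s :: "'n::finite \<Rightarrow> 'n mpoly"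
  using subst_poly_Const[of s 1] by simp

lemma subst_poly_Var: "subst_poly s (Var j) = s j" for s :: "'n::finite \<Rightarrow> 'n mpoly"
proof -
  have "(\<Prod>i\<in>UNIV. s i ^ Poly_Mapping.lookup (Poly_Mapping.single j (1::nat)) i) =
      (\<Prod>i\<in>{j}. s i ^ Poly_Mapping.lookup (Poly_Mapping.single j (1::nat)) i)"
    by (rule prod.mono_neutral_right) (auto simp: lookup_single when_def)
  then show ?thesis
    by (simp add: Var_def subst_poly_single)
qed

lemma subst_poly_prod: "subst_poly s (\<Prod>i\<in>A. f i) = (\<Prod>i\<in>A. subst_poly s (f i))"
  for s :: "'n::finite \<Rightarrow> 'n mpoly"
  by (induction A rule: infinite_finite_induct) (simp_all add: subst_poly_mult)

section \<open>Restriction to coordinate subspaces and residues\<close>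

lemma restrict_poly_0 [simp]: "restrict_poly S 0 = 0"
  by (simp add: restrict_poly_def)

lemma restrict_poly_mult: "restrict_poly S (p * q) = restrict_poly S p * restrict_poly S q"
  for p :: "'n::finite mpoly"
  by (simp add: restrict_poly_def subst_poly_mult)

lemma restrict_poly_sum: "restrict_poly S (\<Sum>i\<in>A. f i) = (\<Sum>i\<in>A. restrict_poly S (f i))"
  by (simp add: restrict_poly_def subst_poly_sum)

lemma restrict_poly_Const: "restrict_poly S (Const c) = Const c" for S :: "'n::finite set"
  by (simp add: restrict_poly_def subst_poly_Const)

text \<open>A single variable from \<open>S\<close> annihilates the monomial. In the adjoint this
  decides which vertices survive the restriction.\<close>

lemma restrict_poly_prod_Var:
  "restrict_poly S (\<Prod>i\<in>A. Var i) = (if A \<inter> S = {} then \<Prod>i\<in>A. Var i else 0)"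
  for S :: "'n::finite set"
proof (cases "A \<inter> S = {}")
  case True
  then show ?thesis
    by (auto simp: restrict_poly_def subst_poly_prod subst_poly_Var intro!: prod.cong)
next
  case False
  then have "(\<Prod>i\<in>A. if i \<in> S then 0 else Var i :: 'n mpoly) = 0"
    by (intro prod_zero) auto
  with False show ?thesis
    by (simp add: restrict_poly_def subst_poly_prod subst_poly_Var)
qed

lemma Var_neq_0: "Var i \<noteq> 0"
proof
  assume "Var i = 0"
  then have "Poly_Mapping.lookup (Var i) (Poly_Mapping.single i 1) = 0"
    by (simp only: lookup_zero)
  then show False
    by (simp add: Var_def)
qed

lemma prod_Var_neq_0: "(\<Prod>i\<in>A. Var i) \<noteq> (0 :: 'n mpoly)" for A :: "'n::{finite,linorder} set"
  by (simp add: Var_neq_0)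

text \<open>Equality of two fractions is the identity \<open>p * q' = p' * q\<close>, which the
  multiplicative restriction preserves; as both restricted denominators are nonzero, the value is
  independent of the representation.\<close>

lemma restrict_ratfun_Fract:
  fixes p q :: "('n::{finite,linorder}) mpoly"
  assumes q: "restrict_poly S q \<noteq> 0"
  shows "restrict_ratfun S (Fract p q) = Fract (restrict_poly S p) (restrict_poly S q)"
  unfolding restrict_ratfun_def
proof (rule the_equality)
  fix g
  assume "\<exists>p' q'. restrict_poly S q' \<noteq> 0 \<and> Fract p q = Fract p' q' \<and>
    g = Fract (restrict_poly S p') (restrict_poly S q')"
  then obtain p' q' where q': "restrict_poly S q' \<noteq> 0" and eq: "Fract p q = Fract p' q'"
    and g: "g = Fract (restrict_poly S p') (restrict_poly S q')"
    by blast
  have "q \<noteq> 0" "q' \<noteq> 0"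
    using q q' by auto
  with eq have "p * q' = p' * q"
    by (simp add: eq_fract)
  then have "restrict_poly S p * restrict_poly S q' = restrict_poly S p' * restrict_poly S q"
    by (metis restrict_poly_mult)
  with q q' g show "g = Fract (restrict_poly S p) (restrict_poly S q)"
    by (simp add: eq_fract)
qed (use q in blast)

lemma Fract_eq_div: "Fract p q = to_fract p / to_fract q"
  by (simp add: to_fract_def)

text \<open>Over the common denominator of all rays, the summand of a cone acquires in its numerator
  the product over the rays outside the cone, as in the adjoint.\<close>

lemma Amp_eq_Adj_div:
  fixes W :: "real ^ 'd ^ ('n::{finite,linorder})"
  shows "Amp J \<Sigma> I W = to_fract (Adj J \<Sigma> I W) / to_fract (\<Prod>i\<in>I. Var i)"
proof -
  have "to_fract (Const (abs_minor J W R)) / to_fract (\<Prod>i\<in>R. Var i) =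
      to_fract (Const (abs_minor J W R) * (\<Prod>i\<in>I - R. Var i)) / to_fract (\<Prod>i\<in>I. Var i)"
    if "R \<subseteq> I" for R
  proof -
    have "(\<Prod>i\<in>I. Var i) = (\<Prod>i\<in>I - R. Var i) * (\<Prod>i\<in>R. Var i :: 'n mpoly)"
      using that by (simp add: prod.subset_diff)
    then show ?thesis
      using prod_Var_neq_0[of R] prod_Var_neq_0[of "I - R"]
      by (simp only: flip: Fract_eq_div) (simp add: eq_fract ac_simps)
  qed
  moreover have "cone_rays I W \<sigma> \<subseteq> I" for \<sigma>
    by (auto simp: cone_rays_def)
  ultimately show ?thesis
    by (simp add: Amp_def Adj_def sum_divide_distrib)
qed

text \<open>Multiplying by the variables in \<open>S\<close> cancels their part of the denominator.
  The rest involves only variables outside \<open>S\<close>, so it restricts to itself and does not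
  vanish.\<close>

lemma res_Amp:
  fixes W :: "real ^ 'd ^ ('n::{finite,linorder})"
  shows "res S (Amp J \<Sigma> UNIV W) =
    to_fract (restrict_poly S (Adj J \<Sigma> UNIV W)) / to_fract (\<Prod>i\<in>-S. Var i)"
proof -
  have "(\<Prod>i\<in>UNIV. Var i) = (\<Prod>i\<in>S. Var i) * (\<Prod>i\<in>-S. Var i :: 'n mpoly)"
    by (subst prod.union_disjoint[symmetric]) auto
  then have "to_fract (\<Prod>i\<in>S. Var i) * Amp J \<Sigma> UNIV W = Fract (Adj J \<Sigma> UNIV W) (\<Prod>i\<in>-S. Var i)"
    using prod_Var_neq_0[of S] prod_Var_neq_0[of "-S"]
    by (simp add: Amp_eq_Adj_div Fract_eq_div)
  then show ?thesis
    using prod_Var_neq_0[of "-S"]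
    by (simp add: res_def restrict_ratfun_Fract restrict_poly_prod_Var) (simp add: Fract_eq_div)
qed

section \<open>Determinants\<close>

text \<open>Two enumerations of the same rows differ by a permutation, which affects only the sign.
  So the enumeration picked by \<open>SOME\<close> in \<open>abs_minor\<close> can be replaced by a
  convenient one.\<close>

lemma abs_det_reindex_rows:
  fixes V :: "real ^ 'd ^ 'n"
    and f g :: "'d \<Rightarrow> 'n"
  assumes f: "bij_betw f UNIV R" and g: "bij_betw g UNIV R"
  shows "\<bar>det (\<chi> j. V $ f j)\<bar> = \<bar>det (\<chi> j. V $ g j)\<bar>"
proof -
  define p where "p = inv_into UNIV f \<circ> g"
  have "bij_betw p UNIV UNIV"
    unfolding p_def using f g by (blast intro: bij_betw_trans bij_betw_inv_into)
  then have p: "p permutes UNIV"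
    by (intro bij_imp_permutes) auto
  have "f (p j) = g j" for j
    using f g by (simp add: p_def bij_betw_def f_inv_into_f image_iff) (metis f_inv_into_f rangeI)
  with det_permute_rows[OF p, of "\<chi> j. V $ f j"]
  have "det (\<chi> j. V $ g j) = of_int (sign p) * det (\<chi> j. V $ f j)"
    by simp
  then show ?thesis
    by (simp add: abs_mult sign_def)
qed

lemma det_on_UNIV: "det_on UNIV A = det (\<chi> i. A i)"
  by (simp add: det_on_def det_def)

text \<open>In the Leibniz sum, a permutation that moves some \<open>j\<close> in \<open>K\<close>
  picks a zero entry of the row \<open>axis j 1\<close>. The other permutations act on
  \<open>-K\<close> alone, and their factors in \<open>K\<close> are 1.\<close>

lemma det_on_axis_rows:
  assumes "\<And>j. j \<in> K \<Longrightarrow> A j = axis j 1"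
  shows "det_on UNIV A = det_on (-K) A"
proof -
  have "(\<Prod>i\<in>UNIV. A i $ p i) = 0" if "p permutes UNIV" "\<not> p permutes -K" for p
  proof -
    have "\<exists>j\<in>K. p j \<noteq> j"
    proof (rule ccontr)
      assume "\<not> (\<exists>j\<in>K. p j \<noteq> j)"
      then have "p permutes -K"
        by (intro permutes_superset[OF that(1)]) auto
      with that show False
        by simp
    qed
    then obtain j where "j \<in> K" "p j \<noteq> j"
      by blast
    with assms[of j] have "A j $ p j = 0"
      by (simp add: axis_def)
    then show ?thesis
      by (auto intro: prod_zero)
  qed
  moreover have "(\<Prod>i\<in>UNIV. A i $ p i) = (\<Prod>i\<in>-K. A i $ p i)" if "p permutes -K" for p
  proof (rule prod.mono_neutral_right)
    show "\<forall>i\<in>UNIV - -K. A i $ p i = 1"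
      using permutes_not_in[OF that] by (simp add: assms)
  qed auto
  ultimately show ?thesis
    unfolding det_on_def
    by (intro sum.mono_neutral_cong_right) (auto intro: permutes_subset simp: finite_permutations)
qed

text \<open>Multiplication by \<open>T\<close> scales the minor by \<open>det T\<close> and turns
  the rows in \<open>S\<close> into unit vectors. Suitably enumerated, the product is block
  triangular with an identity block, so only the complementary block counts.\<close>

lemma abs_minor_block:
  fixes U :: "real ^ 'd ^ 'n"
  assumes e: "bij_betw e S K" and axis: "\<And>i. i \<in> S \<Longrightarrow> (U ** T) $ i = axis (e i) 1"
    and "S \<subseteq> R" and card: "card R = CARD('d)" and "finite R"
  shows "abs_minor UNIV U R * \<bar>det T\<bar> = abs_minor (-K) (face_matrix U T (-K)) (R - S)"
proof -
  have "card (-K) = card (R - S)"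
    using bij_betw_same_card[OF e] \<open>S \<subseteq> R\<close> card \<open>finite R\<close>
    by (subst Compl_eq_Diff_UNIV) (simp only: card_Diff_subset finite_subset finite subset_UNIV)
  then have ex_g: "\<exists>g. bij_betw g (-K) (R - S)"
    using \<open>finite R\<close> by (simp add: finite_same_card_bij)
  have ex_f: "\<exists>f. bij_betw f (UNIV :: 'd set) R"
    using \<open>finite R\<close> card by (simp add: finite_same_card_bij)
  define f where "f = (SOME f. bij_betw f (UNIV :: 'd set) R)"
  define g where "g = (SOME g. bij_betw g (-K) (R - S))"
  have f: "bij_betw f UNIV R" and g: "bij_betw g (-K) (R - S)"
    unfolding f_def g_def by (rule someI_ex[OF ex_f], rule someI_ex[OF ex_g])
  \<comment> \<open>At each position \<open>j\<close> in \<open>K\<close> this enumeration puts the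
    row equal to \<open>axis j 1\<close>; on \<open>-K\<close> it follows the enumeration used by
    the smaller minor.\<close>
  define h where "h j = (if j \<in> K then inv_into S e j else g j)" for j
  have "bij_betw h (K \<union> -K) (S \<union> (R - S))"
  proof (rule bij_betw_combine)
    show "bij_betw h K S"
      using bij_betw_inv_into[OF e] by (simp add: h_def cong: bij_betw_cong)
    show "bij_betw h (-K) (R - S)"
      using g by (rule bij_betw_cong[THEN iffD1, rotated]) (simp add: h_def)
  qed auto
  with \<open>S \<subseteq> R\<close> have h: "bij_betw h UNIV R"
    by (simp add: Un_absorb1 Compl_partition)
  have "abs_minor UNIV U R * \<bar>det T\<bar> = \<bar>det (\<chi> j. U $ h j)\<bar> * \<bar>det T\<bar>"
    using abs_det_reindex_rows[OF f h, of U]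
    by (simp add: abs_minor_def det_on_UNIV flip: f_def)
  also have "\<dots> = \<bar>det ((\<chi> j. U $ h j) ** T)\<bar>"
    by (simp add: det_mul abs_mult)
  also have "(\<chi> j. U $ h j) ** T = (\<chi> j. (U ** T) $ h j)"
    by (simp add: vec_eq_iff matrix_matrix_mult_def)
  also have "\<bar>det \<dots>\<bar> = \<bar>det_on (-K) (\<lambda>j. (U ** T) $ h j)\<bar>"
  proof -
    have "(U ** T) $ h j = axis j 1" if "j \<in> K" for j
      using axis[of "h j"] that e bij_betw_inv_into[OF e]
      by (auto simp: h_def bij_betw_inv_into_right[OF e] bij_betwE)
    then show ?thesis
      by (simp only: det_on_axis_rows[of K] flip: det_on_UNIV)
  qed
  also have "det_on (-K) (\<lambda>j. (U ** T) $ h j) = det_on (-K) (\<lambda>j. face_matrix U T (-K) $ g j)"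
    unfolding det_on_def
  proof (intro sum.cong refl arg_cong2[where f = "(*)"] prod.cong)
    fix p j assume "p \<in> {p. p permutes -K}" "j \<in> -K"
    \<comment> \<open>The column \<open>p j\<close> stays in \<open>-K\<close>, so the projection in
      \<open>face_matrix\<close> does not change the entry.\<close>
    then have "p j \<in> -K"
      by (simp only: mem_Collect_eq permutes_in_image)
    with \<open>j \<in> -K\<close> show "(U ** T) $ h j $ p j = face_matrix U T (-K) $ g j $ p j"
      by (simp add: h_def face_matrix_def coord_proj_def)
  qed
  finally show ?thesis
    by (simp add: abs_minor_def g_def)
qed

section \<open>Simple polyhedra given by inequalities\<close>

lemma subspace_coord_space: "subspace (coord_space J)"
  by (auto simp: subspace_def coord_space_def)

lemma dim_coord_space: "dim (coord_space J) = card J"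
proof -
  let ?B = "(\<lambda>j. axis j (1::real)) ` J"
  have "coord_space J = {x. \<forall>i\<in>Basis. i \<notin> ?B \<longrightarrow> x \<bullet> i = 0}"
    by (auto simp: coord_space_def Basis_vec_def inner_axis axis_eq_axis image_iff)
  moreover have "?B \<subseteq> Basis"
    by (auto simp: Basis_vec_def)
  ultimately have "dim (coord_space J) = card ?B"
    by (simp only: dim_substandard)
  moreover have "inj_on (\<lambda>j. axis j (1::real)) J"
    by (auto simp: inj_on_def axis_eq_axis)
  ultimately show ?thesis
    by (simp only: card_image)
qed

lemma coord_proj_in: "coord_proj J x \<in> coord_space J"
  by (simp add: coord_space_def coord_proj_def)

lemma inner_coord_proj: "z \<in> coord_space J \<Longrightarrow> coord_proj J u \<bullet> z = u \<bullet> z"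
  by (auto simp: coord_space_def coord_proj_def inner_vec_def intro!: sum.cong)

section \<open>Polyhedra, their tight inequalities and their vertices\<close>

definition halfspaces ::
    "'d set \<Rightarrow> 'n set \<Rightarrow> real ^ 'd ^ 'n \<Rightarrow> ('n \<Rightarrow> real) \<Rightarrow> (real ^ 'd) set" where
  "halfspaces J A W b = {x \<in> coord_space J. \<forall>i\<in>A. b i \<le> W $ i \<bullet> x}"

definition tight :: "'n set \<Rightarrow> real ^ 'd ^ 'n \<Rightarrow> ('n \<Rightarrow> real) \<Rightarrow> real ^ 'd \<Rightarrow> 'n set" where
  "tight A W b x = {i \<in> A. W $ i \<bullet> x = b i}"

text \<open>Along \<open>w\<close>, tight inequalities persist by the sign condition and slack ones
  by continuity for small \<open>t\<close>; as there are finitely many, one \<open>t\<close> serves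
  all.\<close>

lemma halfspaces_perturb:
  fixes W :: "real ^ 'd ^ 'n"
  assumes x: "x \<in> halfspaces J A W b" and w: "w \<in> coord_space J"
    and nonneg: "\<And>i. i \<in> tight A W b x \<Longrightarrow> 0 \<le> W $ i \<bullet> w"
  obtains t where "0 < t" "x + t *\<^sub>R w \<in> halfspaces J A W b"
proof -
  have "\<forall>\<^sub>F t in at_right 0. b i \<le> W $ i \<bullet> (x + t *\<^sub>R w)" if "i \<in> A" for i
  proof (cases "i \<in> tight A W b x")
    case True
    then have "b i \<le> W $ i \<bullet> (x + t *\<^sub>R w)" if "t > 0" for t
      using nonneg[OF True] that by (simp add: tight_def inner_add_right)
    then show ?thesis
      using eventually_at_right_less by (rule eventually_mono[rotated])
  next
    case False
    have "((\<lambda>t. W $ i \<bullet> (x + t *\<^sub>R w)) \<longlongrightarrow> W $ i \<bullet> (x + 0 *\<^sub>R w)) (at_right 0)"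
      by (intro tendsto_intros)
    moreover have "b i < W $ i \<bullet> (x + 0 *\<^sub>R w)"
      using False x \<open>i \<in> A\<close> by (force simp: tight_def halfspaces_def)
    ultimately have "\<forall>\<^sub>F t in at_right 0. b i < W $ i \<bullet> (x + t *\<^sub>R w)"
      by (rule order_tendstoD)
    then show ?thesis
      by (rule eventually_mono) simp
  qed
  then have "\<forall>\<^sub>F t in at_right (0::real). \<forall>i\<in>A. b i \<le> W $ i \<bullet> (x + t *\<^sub>R w)"
    by (simp add: eventually_ball_finite)
  then have "\<forall>\<^sub>F t in at_right (0::real). 0 < t \<and> (\<forall>i\<in>A. b i \<le> W $ i \<bullet> (x + t *\<^sub>R w))"
    using eventually_at_right_less by (rule eventually_conj[rotated])
  then obtain t :: real where "0 < t" "\<forall>i\<in>A. b i \<le> W $ i \<bullet> (x + t *\<^sub>R w)"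
    using eventually_happens trivial_limit_at_right_real by blast
  moreover have "x + t *\<^sub>R w \<in> coord_space J"
    using x w by (simp add: halfspaces_def subspace_add subspace_scale subspace_coord_space)
  ultimately show thesis
    by (intro that[of t]) (auto simp: halfspaces_def)
qed

text \<open>This setting is used twice: for the polytope in the full space, and for the coordinate
  image of its face in a smaller space. Inequalities that do not define facets may be
  present.\<close>

locale simple_halfspaces =
  fixes J :: "'d::finite set" and A :: "'n::finite set" and W :: "real ^ 'd ^ 'n" and b :: "'n \<Rightarrow> real"
  assumes W_in: "i \<in> A \<Longrightarrow> W $ i \<in> coord_space J"
    and card_tight_le: "v extreme_point_of halfspaces J A W b \<Longrightarrow> card (tight A W b v) \<le> card J"
begin

abbreviation P where "P \<equiv> halfspaces J A W b"
abbreviation tt where "tt \<equiv> tight A W b"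

text \<open>If the tight rows did not span, a nonzero \<open>w\<close> would be orthogonal to all of
  them. Then \<open>v\<close> could move a little along both \<open>w\<close> and \<open>-w\<close>
  and would not be extreme.\<close>

lemma span_tight:
  assumes v: "v extreme_point_of P"
  shows "span ((\<lambda>i. W $ i) ` tt v) = coord_space J"
proof (rule ccontr)
  assume "span ((\<lambda>i. W $ i) ` tt v) \<noteq> coord_space J"
  moreover have "span ((\<lambda>i. W $ i) ` tt v) \<subseteq> coord_space J"
    by (intro span_minimal subspace_coord_space) (auto simp: tight_def W_in)
  ultimately have "span ((\<lambda>i. W $ i) ` tt v) \<subset> span (coord_space J)"
    by (simp add: span_eq_iff[THEN iffD2, OF subspace_coord_space] psubset_eq)
  then obtain w where w: "w \<noteq> 0" "w \<in> span (coord_space J)"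
    and orth: "\<And>y. y \<in> span ((\<lambda>i. W $ i) ` tt v) \<Longrightarrow> orthogonal w y"
    by (metis orthogonal_to_subspace_exists_gen)
  have wJ: "w \<in> coord_space J" "- w \<in> coord_space J"
    using w(2) span_eq_iff[THEN iffD2, OF subspace_coord_space[of J]]
    by (simp_all add: subspace_neg subspace_coord_space)
  have w0: "W $ i \<bullet> w = 0" if "i \<in> tt v" for i
    using orth[of "W $ i"] that by (simp add: span_base orthogonal_def inner_commute)
  have vP: "v \<in> P"
    using v by (simp add: extreme_point_of_def)
  have nonneg: "0 \<le> W $ i \<bullet> w" "0 \<le> W $ i \<bullet> - w" if "i \<in> tt v" for i
    using w0[OF that] by simp_all
  obtain s where s: "0 < s" "v + s *\<^sub>R w \<in> P"
    using halfspaces_perturb[OF vP wJ(1) nonneg(1)] by blast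
  obtain t where t: "0 < t" "v + t *\<^sub>R - w \<in> P"
    using halfspaces_perturb[OF vP wJ(2) nonneg(2)] by blast
  \<comment> \<open>The weight solves \<open>(1 - l) * s = l * t\<close>, so the two opposite
    displacements cancel in the convex combination.\<close>
  define l where "l = s / (s + t)"
  have "(1 - l) * s - l * t = 0"
    using s t by (simp add: l_def field_simps)
  moreover have "(1 - l) *\<^sub>R (v + s *\<^sub>R w) + l *\<^sub>R (v + t *\<^sub>R - w) = v + ((1 - l) * s - l * t) *\<^sub>R w"
    by (simp add: algebra_simps)
  ultimately have "v = (1 - l) *\<^sub>R (v + s *\<^sub>R w) + l *\<^sub>R (v + t *\<^sub>R - w)"
    by simp
  moreover have "0 < l" "l < 1"
    using s t by (simp_all add: l_def field_simps)
  moreover have "v + s *\<^sub>R w \<noteq> v + t *\<^sub>R - w"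
  proof
    assume "v + s *\<^sub>R w = v + t *\<^sub>R - w"
    then have "(s + t) *\<^sub>R w = 0"
      by (simp add: algebra_simps)
    with s t w show False
      by simp
  qed
  ultimately have "v \<in> open_segment (v + s *\<^sub>R w) (v + t *\<^sub>R - w)"
    unfolding in_segment by blast
  with v s t show False
    by (simp add: extreme_point_of_def)
qed

text \<open>At most \<open>card J\<close> rows span a space of dimension \<open>card J\<close>, so
  they are a basis and no two of them coincide.\<close>

lemma
  assumes v: "v extreme_point_of P"
  shows card_tight: "card (tt v) = card J"
    and inj_tight: "inj_on (\<lambda>i. W $ i) (tt v)"
    and independent_tight: "independent ((\<lambda>i. W $ i) ` tt v)"
proof -
  let ?B = "(\<lambda>i. W $ i) ` tt v"
  have "card J = dim ?B"
    using span_tight[OF v] dim_coord_space[of J] dim_span[of ?B] by simp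
  moreover have "dim ?B \<le> card ?B"
    by (simp add: dim_le_card')
  moreover have "card ?B \<le> card (tt v)"
    by (simp add: card_image_le)
  ultimately have eq: "card (tt v) = card J" "card ?B = card (tt v)" "card ?B \<le> dim ?B"
    using card_tight_le[OF v] by auto
  show "card (tt v) = card J"
    by (rule eq(1))
  show "inj_on (\<lambda>i. W $ i) (tt v)"
    by (rule eq_card_imp_inj_on[OF _ eq(2)]) simp
  show "independent ?B"
    by (rule card_le_dim_spanning[OF subset_refl span_superset _ eq(3)]) simp
qed

text \<open>The vectors \<open>w j\<close> are the edge directions of \<open>P\<close> at \<open>v\<close>.\<close>

lemma dual_basis:
  assumes v: "v extreme_point_of P"
  obtains w where "\<And>j. j \<in> tt v \<Longrightarrow> w j \<in> coord_space J"
    and "\<And>i j. i \<in> tt v \<Longrightarrow> j \<in> tt v \<Longrightarrow> W $ i \<bullet> w j = (if i = j then 1 else 0)"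
proof -
  have "\<exists>w. w \<in> coord_space J \<and> (\<forall>i\<in>tt v. W $ i \<bullet> w = (if i = j then 1 else 0))" if j: "j \<in> tt v" for j
  proof -
    let ?B = "(\<lambda>i. W $ i) ` (tt v - {j})"
    \<comment> \<open>The component \<open>z\<close> is orthogonal to the other tight rows, is
      nonzero by independence, and pairs with \<open>W $ j\<close> to \<open>z \<bullet> z\<close>;
      dividing by this number gives the dual vector.\<close>
    obtain y z where y: "y \<in> span ?B" and z: "\<And>w. w \<in> span ?B \<Longrightarrow> orthogonal z w"
      and eq: "W $ j = y + z"
      using orthogonal_subspace_decomp_exists[of ?B "W $ j"] by metis
    have "?B = (\<lambda>i. W $ i) ` tt v - {W $ j}"
      using inj_tight[OF v] j by (auto dest: inj_onD)
    then have "W $ j \<notin> span ?B"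
      using independent_tight[OF v] j by (auto simp: dependent_def)
    with y eq have "z \<noteq> 0"
      by auto
    have "?B \<subseteq> coord_space J"
      by (auto simp: tight_def W_in)
    then have "y \<in> coord_space J"
      using y span_minimal subspace_coord_space by blast
    moreover have "z = W $ j - y"
      by (simp add: eq)
    ultimately have "z \<in> coord_space J"
      using W_in[of j] j by (simp add: tight_def subspace_diff subspace_coord_space)
    moreover have "W $ i \<bullet> z = 0" if "i \<in> tt v - {j}" for i
      using z[of "W $ i"] that by (simp add: span_base orthogonal_def inner_commute)
    moreover have "y \<bullet> z = 0"
      using z[OF y] by (simp add: orthogonal_def inner_commute)
    then have "W $ j \<bullet> z = z \<bullet> z"
      by (simp add: eq inner_add_left)
    ultimately show ?thesis
      using \<open>z \<noteq> 0\<close>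
      by (intro exI[of _ "z /\<^sub>R (z \<bullet> z)"]) (auto simp: subspace_scale subspace_coord_space)
  qed
  then show thesis
    using that by metis
qed

text \<open>Both sides are linear in \<open>u\<close> and agree on the tight rows, which span the
  space.\<close>

lemma dual_basis_expansion:
  assumes v: "v extreme_point_of P"
    and w: "\<And>i j. i \<in> tt v \<Longrightarrow> j \<in> tt v \<Longrightarrow> W $ i \<bullet> w j = (if i = j then 1 else 0)"
    and "u \<in> coord_space J"
  shows "u = (\<Sum>i\<in>tt v. (u \<bullet> w i) *\<^sub>R W $ i)"
proof -
  have "u \<in> span ((\<lambda>i. W $ i) ` tt v)"
    using assms by (simp add: span_tight)
  then show ?thesis
  proof (rule span_induct)
    let ?f = "\<lambda>u. \<Sum>i\<in>tt v. (u \<bullet> w i) *\<^sub>R W $ i"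
    have "linear ?f"
      by (rule linearI) (simp_all add: inner_add_left scaleR_add_left sum.distrib scaleR_sum_right)
    then have "linear (\<lambda>u. u - ?f u)"
      by (intro linear_compose_sub linear_ident)
    then show "subspace {u. u = ?f u}"
      using linear_subspace_kernel[of "\<lambda>u. u - ?f u"] by (simp only: right_minus_eq)
  next
    fix x assume "x \<in> (\<lambda>i. W $ i) ` tt v"
    then show "x = (\<Sum>i\<in>tt v. (x \<bullet> w i) *\<^sub>R W $ i)"
      by (auto simp: w if_distrib[of "\<lambda>c. c *\<^sub>R _"] cong: if_cong)
  qed
qed

section \<open>Normal cones of vertices and the maximal cones of the fan\<close>

lemma normal_cone_vertex:
  assumes v: "v extreme_point_of P"
    and w_in: "\<And>j. j \<in> tt v \<Longrightarrow> w j \<in> coord_space J"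
    and w: "\<And>i j. i \<in> tt v \<Longrightarrow> j \<in> tt v \<Longrightarrow> W $ i \<bullet> w j = (if i = j then 1 else 0)"
  shows "normal_cone J P {v} = {u \<in> coord_space J. \<forall>i\<in>tt v. 0 \<le> u \<bullet> w i}"
proof (intro equalityI subsetI)
  fix u assume u: "u \<in> normal_cone J P {v}"
  have "0 \<le> u \<bullet> w i" if i: "i \<in> tt v" for i
  proof -
    have "v \<in> P"
      using v by (simp add: extreme_point_of_def)
    moreover have "0 \<le> W $ l \<bullet> w i" if "l \<in> tt v" for l
      using i that by (simp add: w)
    ultimately obtain t where "0 < t" "v + t *\<^sub>R w i \<in> P"
      using halfspaces_perturb[OF _ w_in[OF i]] by blast
    then have "u \<bullet> v \<le> u \<bullet> (v + t *\<^sub>R w i)"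
      using u by (simp add: normal_cone_def)
    with \<open>0 < t\<close> show ?thesis
      by (simp add: inner_add_right zero_le_mult_iff)
  qed
  with u show "u \<in> {u \<in> coord_space J. \<forall>i\<in>tt v. 0 \<le> u \<bullet> w i}"
    by (simp add: normal_cone_def)
next
  fix u assume u: "u \<in> {u \<in> coord_space J. \<forall>i\<in>tt v. 0 \<le> u \<bullet> w i}"
  have "u \<bullet> v \<le> u \<bullet> y" if y: "y \<in> P" for y
  proof -
    \<comment> \<open>Expanding \<open>u\<close> in the tight rows leaves nonnegative coefficients
      times the slacks of \<open>y\<close>.\<close>
    have "u \<bullet> (y - v) = (\<Sum>i\<in>tt v. (u \<bullet> w i) * (W $ i \<bullet> (y - v)))"
      by (subst dual_basis_expansion[OF v w, of u]) (use u in \<open>auto simp: inner_sum_left\<close>)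
    also have "\<dots> \<ge> 0"
      using u y by (intro sum_nonneg mult_nonneg_nonneg)
        (auto simp: tight_def halfspaces_def inner_diff_right)
    finally show ?thesis
      by (simp add: inner_diff_right)
  qed
  with u show "u \<in> normal_cone J P {v}"
    by (simp add: normal_cone_def)
qed

lemma tight_in_normal_cone:
  assumes "i \<in> tt v"
  shows "W $ i \<in> normal_cone J P {v}"
  using assms by (auto simp: normal_cone_def tight_def halfspaces_def W_in)

text \<open>A row in the cone is minimal over \<open>P\<close> at \<open>v\<close>; since the bound
  \<open>b j\<close> is attained somewhere, it is attained at \<open>v\<close>. Conversely, each
  tight row spans an exposed ray of the simplicial cone.\<close>

lemma cone_rays_vertex:
  assumes v: "v extreme_point_of P"
  shows "cone_rays {i \<in> A. \<exists>x\<in>P. W $ i \<bullet> x = b i} W (normal_cone J P {v}) = tt v"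
proof (intro equalityI subsetI)
  fix j assume j: "j \<in> cone_rays {i \<in> A. \<exists>x\<in>P. W $ i \<bullet> x = b i} W (normal_cone J P {v})"
  then have "W $ j \<in> normal_cone J P {v}"
    using face_of_imp_subset hull_subset[of "{W $ j}"] by (fastforce simp: cone_rays_def)
  moreover have "v \<in> P"
    using v by (simp add: extreme_point_of_def)
  ultimately show "j \<in> tt v"
    using j by (fastforce simp: cone_rays_def normal_cone_def tight_def halfspaces_def)
next
  fix j assume j: "j \<in> tt v"
  obtain w where w_in: "\<And>j. j \<in> tt v \<Longrightarrow> w j \<in> coord_space J"
    and w: "\<And>i j. i \<in> tt v \<Longrightarrow> j \<in> tt v \<Longrightarrow> W $ i \<bullet> w j = (if i = j then 1 else 0)"
    using dual_basis[OF v] by blast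
  define \<sigma> where "\<sigma> = normal_cone J P {v}"
  have \<sigma>: "\<sigma> = {u \<in> coord_space J. \<forall>i\<in>tt v. 0 \<le> u \<bullet> w i}"
    unfolding \<sigma>_def by (rule normal_cone_vertex[OF v w_in w])
  \<comment> \<open>The sum of the other edge directions is nonnegative on \<open>\<sigma>\<close>
    and vanishes only where all coordinates but the \<open>j\<close>-th do, so its zero hyperplane
    cuts out the ray of \<open>W $ j\<close>.\<close>
  define s where "s = (\<Sum>i\<in>tt v - {j}. w i)"
  have su: "s \<bullet> u = (\<Sum>i\<in>tt v - {j}. u \<bullet> w i)" for u
    by (simp add: s_def inner_sum_right inner_commute[of _ u])
  have "convex \<sigma>"
    unfolding \<sigma>_def normal_cone_def convex_def
    by (auto simp: subspace_add subspace_scale subspace_coord_space inner_add_left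
        intro!: add_mono mult_left_mono)
  then have "(\<sigma> \<inter> {u. s \<bullet> u = 0}) face_of \<sigma>"
    by (rule face_of_Int_supporting_hyperplane_ge) (auto simp: su \<sigma> intro!: sum_nonneg)
  also have "\<sigma> \<inter> {u. s \<bullet> u = 0} = conic hull {W $ j}"
  proof (intro equalityI subsetI)
    fix u assume u: "u \<in> \<sigma> \<inter> {u. s \<bullet> u = 0}"
    then have "\<forall>i\<in>tt v - {j}. u \<bullet> w i = 0"
      using sum_nonneg_eq_0_iff[of "tt v - {j}" "\<lambda>i. u \<bullet> w i"] by (auto simp: \<sigma> su)
    then have "u = (u \<bullet> w j) *\<^sub>R W $ j"
      using dual_basis_expansion[OF v w, of u] u j by (simp add: \<sigma> sum.remove[of _ j])
    with u j show "u \<in> conic hull {W $ j}"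
      by (auto simp: conic_hull_explicit \<sigma>)
  next
    fix u assume "u \<in> conic hull {W $ j}"
    then obtain c where "0 \<le> c" "u = c *\<^sub>R W $ j"
      by (auto simp: conic_hull_explicit)
    moreover have "W $ j \<in> coord_space J"
      using j by (simp add: tight_def W_in)
    ultimately show "u \<in> \<sigma> \<inter> {u. s \<bullet> u = 0}"
      using j by (auto simp: \<sigma> su w subspace_scale subspace_coord_space intro!: sum.neutral split: if_splits)
  qed
  finally show "j \<in> cone_rays {i \<in> A. \<exists>x\<in>P. W $ i \<bullet> x = b i} W (normal_cone J P {v})"
    using j v by (auto simp: cone_rays_def \<sigma>_def tight_def extreme_point_of_def)
qed

text \<open>The cone of a vertex contains a spanning set of rows, so it has full dimension and
  determines the vertex. If a face has two distinct points, its cone lies in the hyperplane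
  orthogonal to their difference and is not maximal.\<close>

lemma bij_betw_vertices_max_cones:
  "bij_betw (\<lambda>v. normal_cone J P {v}) {v. v extreme_point_of P} (max_cones J (normal_fan J P))"
proof (rule bij_betwI')
  fix v y assume "v \<in> {v. v extreme_point_of P}" "y \<in> {v. v extreme_point_of P}"
  then have v: "v extreme_point_of P" and y: "y extreme_point_of P"
    by simp_all
  then have P: "v \<in> P" "y \<in> P"
    by (simp_all add: extreme_point_of_def)
  show "normal_cone J P {v} = normal_cone J P {y} \<longleftrightarrow> v = y"
  proof
    assume eq: "normal_cone J P {v} = normal_cone J P {y}"
    \<comment> \<open>Row \<open>i\<close> lies in both cones, so it attains its minimum over
      \<open>P\<close> at \<open>v\<close> and at \<open>y\<close> alike.\<close>
    have "W $ i \<bullet> (v - y) = 0" if "i \<in> tt v" for i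
      using tight_in_normal_cone[OF that] tight_in_normal_cone[OF that, unfolded eq] P
      by (force simp: normal_cone_def inner_diff_right)
    then have "(v - y) \<bullet> u = 0" if "u \<in> span ((\<lambda>i. W $ i) ` tt v)" for u
      using orthogonal_to_span[OF that, of "v - y"] by (auto simp: orthogonal_def inner_commute)
    moreover have "v - y \<in> coord_space J"
      using P by (simp add: halfspaces_def subspace_diff subspace_coord_space)
    ultimately have "(v - y) \<bullet> (v - y) = 0"
      using span_tight[OF v] by blast
    then show "v = y"
      by simp
  qed simp
next
  fix v assume "v \<in> {v. v extreme_point_of P}"
  then have v: "v extreme_point_of P"
    by simp
  have "card J = dim ((\<lambda>i. W $ i) ` tt v)"
    using span_tight[OF v] dim_coord_space[of J] dim_span[of "(\<lambda>i. W $ i) ` tt v"] by simp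
  also have "\<dots> \<le> dim (normal_cone J P {v})"
    by (intro dim_subset) (auto intro: tight_in_normal_cone)
  finally have "card J \<le> dim (normal_cone J P {v})" .
  moreover have "dim (normal_cone J P {v}) \<le> card J"
    unfolding dim_coord_space[symmetric] by (intro dim_subset) (auto simp: normal_cone_def)
  ultimately show "normal_cone J P {v} \<in> max_cones J (normal_fan J P)"
    using v by (auto simp: max_cones_def normal_fan_def face_of_singleton intro!: exI[of _ "{v}"])
next
  fix \<sigma> assume \<sigma>: "\<sigma> \<in> max_cones J (normal_fan J P)"
  then obtain F where F: "F face_of P" "F \<noteq> {}" and eq: "\<sigma> = normal_cone J P F"
    by (auto simp: max_cones_def normal_fan_def)
  obtain v where "v \<in> F"
    using F by blast
  have "F = {v}"
  proof (rule ccontr)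
    assume "F \<noteq> {v}"
    then obtain y where "y \<in> F" "y \<noteq> v"
      using \<open>v \<in> F\<close> by blast
    have vy: "v \<in> P" "y \<in> P"
      using \<open>v \<in> F\<close> \<open>y \<in> F\<close> F face_of_imp_subset by blast+
    let ?H = "coord_space J \<inter> {u. (v - y) \<bullet> u = 0}"
    have "\<sigma> \<subseteq> ?H"
    proof
      fix u assume "u \<in> \<sigma>"
      then have "u \<in> coord_space J" "u \<bullet> v = u \<bullet> y"
        using \<open>v \<in> F\<close> \<open>y \<in> F\<close> vy by (auto simp: eq normal_cone_def intro: antisym)
      then show "u \<in> ?H"
        by (simp add: inner_diff_right inner_commute[of _ u])
    qed
    moreover have "v - y \<in> coord_space J - ?H"
      using vy \<open>y \<noteq> v\<close> by (simp add: halfspaces_def subspace_diff subspace_coord_space)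
    moreover have "subspace ?H"
      by (intro subspace_inter subspace_coord_space subspace_hyperplane)
    ultimately have "span \<sigma> \<subset> coord_space J"
      using span_minimal[of \<sigma> ?H] by blast
    then have "dim \<sigma> < dim (coord_space J)"
      by (intro dim_psubset) (simp add: span_eq_iff[THEN iffD2, OF subspace_coord_space])
    with \<sigma> show False
      by (simp add: max_cones_def dim_coord_space)
  qed
  with F eq show "\<exists>v\<in>{v. v extreme_point_of P}. \<sigma> = normal_cone J P {v}"
    by (auto simp: face_of_singleton)
qed

text \<open>Amplitude and adjoint see a cone only through its rays, so they become sums over
  vertices and their tight sets.\<close>

lemma sum_max_cones:
  "(\<Sum>\<sigma>\<in>max_cones J (normal_fan J P). g (cone_rays {i \<in> A. \<exists>x\<in>P. W $ i \<bullet> x = b i} W \<sigma>)) =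
     (\<Sum>v | v extreme_point_of P. g (tt v))"
  by (subst sum.reindex_bij_betw[OF bij_betw_vertices_max_cones, symmetric])
    (simp add: cone_rays_vertex)

text \<open>The edge directions dual to the tight rows outside \<open>S\<close> are independent, and
  moving from \<open>v\<close> along them keeps the rows in \<open>S\<close> tight.\<close>

lemma aff_dim_tight_face:
  assumes v: "v extreme_point_of P" and "S \<subseteq> tt v"
  shows "int (card J) - int (card S) \<le> aff_dim {x \<in> P. S \<subseteq> tt x}"
proof -
  let ?G = "{x \<in> P. S \<subseteq> tt x}" and ?R = "tt v - S"
  obtain w where w_in: "\<And>j. j \<in> tt v \<Longrightarrow> w j \<in> coord_space J"
    and w: "\<And>i j. i \<in> tt v \<Longrightarrow> j \<in> tt v \<Longrightarrow> W $ i \<bullet> w j = (if i = j then 1 else 0)"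
    using dual_basis[OF v] by blast
  have vP: "v \<in> P"
    using v by (simp add: extreme_point_of_def)
  have coeff: "a l = 0" if "(\<Sum>j\<in>?R. a j *\<^sub>R w j) = 0" "l \<in> ?R" for a l
  proof -
    have "(\<Sum>j\<in>?R. a j * (W $ l \<bullet> w j)) = 0"
      using arg_cong[OF that(1), of "\<lambda>x. W $ l \<bullet> x"] by (simp add: inner_sum_right)
    also have "(\<Sum>j\<in>?R. a j * (W $ l \<bullet> w j)) = (\<Sum>j\<in>?R. if l = j then a j else 0)"
      using that by (intro sum.cong) (auto simp: w)
    finally show ?thesis
      using that by simp
  qed
  have inj: "inj_on w ?R"
    by (intro inj_onI) (metis DiffD1 w zero_neq_one)
  have "independent (w ` ?R)"
  proof (rule independent_if_scalars_zero)
    fix f x assume f: "(\<Sum>x\<in>w ` ?R. f x *\<^sub>R x) = 0" and "x \<in> w ` ?R"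
    then obtain l where "l \<in> ?R" "x = w l"
      by blast
    then show "f x = 0"
      using coeff[of "f \<circ> w" l] f by (simp add: sum.reindex[OF inj])
  qed simp
  have "w j \<in> span ((+) (- v) ` ?G)" if j: "j \<in> ?R" for j
  proof -
    have "0 \<le> W $ l \<bullet> w j" if "l \<in> tt v" for l
      using j that by (simp add: w)
    with j obtain t where t: "0 < t" "v + t *\<^sub>R w j \<in> P"
      using halfspaces_perturb[OF vP w_in[of j]] by blast
    moreover have "S \<subseteq> tt (v + t *\<^sub>R w j)"
      using j \<open>S \<subseteq> tt v\<close> w by (fastforce simp: tight_def inner_add_right)
    ultimately have "t *\<^sub>R w j \<in> (+) (- v) ` ?G"
      by (force simp: image_iff)
    then have "(1 / t) *\<^sub>R (t *\<^sub>R w j) \<in> span ((+) (- v) ` ?G)"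
      by (intro span_mul span_base)
    with t show ?thesis
      by simp
  qed
  then have "card (w ` ?R) \<le> dim (span ((+) (- v) ` ?G))"
    by (intro independent_card_le_dim \<open>independent (w ` ?R)\<close>) auto
  moreover have "aff_dim ?G = int (dim ((+) (- v) ` ?G))"
    using vP \<open>S \<subseteq> tt v\<close> by (intro aff_dim_eq_dim hull_inc) simp
  moreover have "card (w ` ?R) + card S = card J"
    using card_tight[OF v] \<open>S \<subseteq> tt v\<close> card_mono[OF _ \<open>S \<subseteq> tt v\<close>]
    by (simp add: card_image[OF inj] card_Diff_subset)
  ultimately show ?thesis
    by simp
qed

end

section \<open>Simple polytopes and their faces\<close>

lemma facet_inequality:
  fixes P :: "(real ^ 'd) set"
  assumes "convex P" and full: "aff_dim P = int CARD('d)" and F: "F facet_of P"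
    and "u \<noteq> 0" and u: "u \<in> normal_cone UNIV P F"
  shows "\<exists>c. F = {x \<in> P. u \<bullet> x = c} \<and> (\<forall>x\<in>P. c \<le> u \<bullet> x)"
proof -
  obtain x0 where "x0 \<in> F"
    using F by (auto simp: facet_of_def)
  define c where "c = u \<bullet> x0"
  have ge: "c \<le> u \<bullet> x" if "x \<in> P" for x
    using u \<open>x0 \<in> F\<close> that by (auto simp: normal_cone_def c_def)
  have eq: "u \<bullet> x = c" if "x \<in> F" for x
  proof (rule antisym)
    have "x0 \<in> P"
      using \<open>x0 \<in> F\<close> facet_of_imp_subset[OF F] by blast
    then show "u \<bullet> x \<le> c"
      using u that by (auto simp: normal_cone_def c_def)
    show "c \<le> u \<bullet> x"
      using that facet_of_imp_subset[OF F] by (auto intro: ge)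
  qed
  \<comment> \<open>This exposed face contains \<open>F\<close>, and it is proper because
    \<open>u\<close> is nonzero and \<open>P\<close> is full-dimensional. A facet is not properly
    contained in another proper face, so the two agree.\<close>
  let ?G = "P \<inter> {x. u \<bullet> x = c}"
  have G: "?G face_of P"
    using \<open>convex P\<close> ge by (rule face_of_Int_supporting_hyperplane_ge)
  have "?G \<noteq> P"
  proof
    assume "?G = P"
    then have "aff_dim P \<le> aff_dim {x. u \<bullet> x = c}"
      by (intro aff_dim_subset) auto
    with full \<open>u \<noteq> 0\<close> show False
      by simp
  qed
  with \<open>convex P\<close> G have "aff_dim ?G < aff_dim P"
    by (rule face_of_aff_dim_lt)
  have "F face_of ?G"
    using facet_of_imp_face_of[OF F] facet_of_imp_subset[OF F] eq
    by (auto intro: face_of_subset[of F P])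
  moreover have "convex ?G"
    using G by (rule face_of_imp_convex)
  moreover have "\<not> aff_dim F < aff_dim ?G"
    using F \<open>aff_dim ?G < aff_dim P\<close> by (simp add: facet_of_def)
  ultimately have "F = ?G"
    by (metis face_of_aff_dim_lt)
  with ge show ?thesis
    by (intro exI[of _ c]) auto
qed

text \<open>From an interior point, the segment to a point \<open>x\<close> outside \<open>P\<close>
  leaves through some facet. If \<open>x\<close> satisfied all inequalities, that of this facet,
  strict at the interior point, would be strict at the crossing point as well.\<close>

lemma polytope_eq_halfspaces:
  fixes P :: "(real ^ 'd) set" and U :: "real ^ 'd ^ 'n"
  assumes "polytope P" and full: "aff_dim P = int CARD('d)"
    and facets: "range facet = {F. F facet_of P}"
    and facet: "\<And>i. facet i = {x \<in> P. U $ i \<bullet> x = b i}"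
    and ge: "\<And>i x. x \<in> P \<Longrightarrow> b i \<le> U $ i \<bullet> x"
  shows "P = halfspaces UNIV UNIV U b"
proof (intro equalityI subsetI)
  fix x assume "x \<in> P"
  with ge show "x \<in> halfspaces UNIV UNIV U b"
    by (simp add: halfspaces_def coord_space_def)
next
  fix x assume x: "x \<in> halfspaces UNIV UNIV U b"
  show "x \<in> P"
  proof (rule ccontr)
    assume "x \<notin> P"
    have boundary: "P - rel_interior P = \<Union> {F. F facet_of P}"
      using assms(1) by (intro rel_boundary_of_polyhedron polytope_imp_polyhedron)
    have "P \<noteq> {}"
      using full by auto
    then obtain y where y: "y \<in> rel_interior P"
      using rel_interior_eq_empty[of P] polytope_imp_convex[OF assms(1)] by blast
    then have "y \<in> P"
      using rel_interior_subset by blast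
    then have "closed_segment y x \<inter> frontier P \<noteq> {}"
      using \<open>x \<notin> P\<close> by (intro connected_Int_frontier connected_segment) auto
    then obtain z where z: "z \<in> closed_segment y x" "z \<in> frontier P"
      by blast
    have "frontier P = P - rel_interior P"
      using full polytope_imp_closed[OF assms(1)] interior_rel_interior_gen[of P]
      by (simp add: frontier_def)
    with z boundary facets obtain i where i: "z \<in> facet i"
      by blast
    have "y \<notin> facet i"
      using y boundary facets by blast
    then have "b i < U $ i \<bullet> y"
      using ge[OF \<open>y \<in> P\<close>, of i] \<open>y \<in> P\<close> by (auto simp: facet order_less_le)
    obtain t where t: "0 \<le> t" "t \<le> 1" "z = (1 - t) *\<^sub>R y + t *\<^sub>R x"
      using z(1) by (auto simp: closed_segment_def)
    have "z \<in> P" "U $ i \<bullet> z = b i"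
      using i by (auto simp: facet)
    with \<open>x \<notin> P\<close> t have "t < 1"
      by (cases "t = 1") auto
    then have "(1 - t) * b i < (1 - t) * (U $ i \<bullet> y)"
      using \<open>b i < U $ i \<bullet> y\<close> by simp
    moreover have "t * b i \<le> t * (U $ i \<bullet> x)"
      using x t by (intro mult_left_mono) (auto simp: halfspaces_def)
    ultimately have "b i < U $ i \<bullet> z"
      by (simp add: t inner_add_right algebra_simps)
    with \<open>U $ i \<bullet> z = b i\<close> show False
      by simp
  qed
qed


text \<open>The ray matrix condition takes the form of facet inequalities: \<open>b i\<close> is the
  minimum of row \<open>i\<close> over \<open>P\<close>, attained exactly on
  \<open>facet i\<close>.\<close>

locale simple_polytope_face =
  fixes U :: "real ^ 'd ^ ('n::{finite,linorder})"
    and P \<Delta> :: "(real ^ 'd) set"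
    and facet :: "'n \<Rightarrow> (real ^ 'd) set"
    and T :: "real ^ 'd ^ 'd"
    and k :: nat
    and K :: "'d set"
    and e :: "'n \<Rightarrow> 'd"
    and b :: "'n \<Rightarrow> real"
  assumes simple: "simple_polytope P"
    and full: "aff_dim P = int CARD('d)"
    and facets: "bij_betw facet UNIV {F. F facet_of P}"
    and facet_eq: "\<And>i. facet i = {x \<in> P. U $ i \<bullet> x = b i}"
    and facet_ge: "\<And>i x. x \<in> P \<Longrightarrow> b i \<le> U $ i \<bullet> x"
    and face: "\<Delta> face_of P" and nonempty: "\<Delta> \<noteq> {}"
    and aff_dim_face: "aff_dim \<Delta> = int CARD('d) - int k"
    and inv_T: "invertible T"
    and card_K: "card K = k"
    and bij_e: "bij_betw e {Q. \<Delta> \<subseteq> facet Q} K"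
    and axis_rows: "\<And>Q. \<Delta> \<subseteq> facet Q \<Longrightarrow> (U ** T) $ Q = axis (e Q) 1"
begin

section \<open>The face in terms of tight inequalities\<close>

abbreviation S where "S \<equiv> {Q. \<Delta> \<subseteq> facet Q}"

lemma polytope_P: "polytope P"
  using simple by (simp add: simple_polytope_def)

lemma range_facet: "range facet = {F. F facet_of P}"
  using facets by (simp add: bij_betw_def)

lemma facet_i: "facet i facet_of P"
  using range_facet by blast

lemma P_eq: "P = halfspaces UNIV UNIV U b"
  by (rule polytope_eq_halfspaces[OF polytope_P full range_facet facet_eq facet_ge])

lemma tight_iff: "x \<in> P \<Longrightarrow> i \<in> tight UNIV U b x \<longleftrightarrow> x \<in> facet i"
  by (simp add: tight_def facet_eq)

lemma card_tight_P:
  assumes v: "v extreme_point_of P"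
  shows "card (tight UNIV U b v) = CARD('d)"
proof -
  have "v \<in> P"
    using v by (simp add: extreme_point_of_def)
  then have "facet ` tight UNIV U b v = {F \<in> range facet. v \<in> F}"
    by (auto simp: tight_iff)
  then have "facet ` tight UNIV U b v = {F. F facet_of P \<and> v \<in> F}"
    by (simp add: range_facet)
  moreover have "inj_on facet (tight UNIV U b v)"
    using facets by (auto simp: bij_betw_def intro: inj_on_subset)
  ultimately have "card (tight UNIV U b v) = card {F. F facet_of P \<and> v \<in> F}"
    by (metis card_image)
  with simple v full show ?thesis
    by (simp add: simple_polytope_def)
qed

sublocale P: simple_halfspaces UNIV UNIV U b
proof
  show "card (tight UNIV U b v) \<le> card (UNIV :: 'd set)"
    if "v extreme_point_of halfspaces UNIV UNIV U b" for v
    using that card_tight_P by (simp flip: P_eq)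
qed (simp add: coord_space_def)

text \<open>A nonempty proper face is the intersection of the facets containing it. The face
  \<open>P\<close> itself lies in no facet, so there \<open>S\<close> is empty.\<close>

lemma face_eq: "\<Delta> = {x \<in> P. S \<subseteq> tight UNIV U b x}"
proof (cases "\<Delta> = P")
  case True
  have "\<not> P \<subseteq> facet i" for i
    using facet_i[of i] facet_of_imp_subset[OF facet_i[of i]] facet_of_irrefl[of P] by auto
  with True have "S = {}"
    by simp
  with True show ?thesis
    by simp
next
  case False
  then have "\<Delta> = \<Inter> {F. F facet_of P \<and> \<Delta> \<subseteq> F}"
    using polytope_P face nonempty by (intro face_of_polyhedron polytope_imp_polyhedron)
  also have "{F. F facet_of P \<and> \<Delta> \<subseteq> F} = {F \<in> range facet. \<Delta> \<subseteq> F}"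
    by (simp add: range_facet)
  also have "\<dots> = facet ` S"
    by auto
  finally have "\<Delta> = (\<Inter>i\<in>S. facet i)" .
  moreover have "\<Delta> \<subseteq> P"
    using face by (rule face_of_imp_subset)
  ultimately have "x \<in> \<Delta> \<longleftrightarrow> x \<in> P \<and> S \<subseteq> tight UNIV U b x" for x
    using tight_iff[of x] by blast
  then show ?thesis
    by blast
qed

lemma card_S: "card S = k"
  using bij_betw_same_card[OF bij_e] card_K by simp

text \<open>A facet containing \<open>\<Delta>\<close> cuts out \<open>\<Delta>\<close> itself,
  which is not its own facet. Otherwise, at a vertex of a nonempty intersection the
  \<open>k + 1\<close> rows in \<open>insert i S\<close> are tight, so the codimension in
  \<open>P\<close> is at most \<open>k + 1\<close>, while the intersection is a proper face of
  \<open>\<Delta>\<close>.\<close>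

lemma face_rows_eq: "face_rows facet \<Delta> = {i. i \<notin> S \<and> facet i \<inter> \<Delta> \<noteq> {}}"
proof (intro equalityI subsetI)
  fix i assume "i \<in> face_rows facet \<Delta>"
  then have "facet i \<inter> \<Delta> facet_of \<Delta>"
    by (simp add: face_rows_def)
  then show "i \<in> {i. i \<notin> S \<and> facet i \<inter> \<Delta> \<noteq> {}}"
    by (auto simp: facet_of_def Int_absorb1)
next
  fix i assume "i \<in> {i. i \<notin> S \<and> facet i \<inter> \<Delta> \<noteq> {}}"
  then have i: "i \<notin> S" "facet i \<inter> \<Delta> \<noteq> {}"
    by simp_all
  let ?G = "facet i \<inter> \<Delta>"
  have G: "?G face_of P"
    using facet_of_imp_face_of[OF facet_i] face by (rule face_of_Int)
  have "polytope ?G"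
    using polytope_P G by (rule face_of_polytope_polytope)
  then obtain v where v: "v extreme_point_of ?G"
    using i(2) by (metis extreme_point_exists_convex polytope_imp_compact polytope_imp_convex)
  then have "v extreme_point_of P" "v \<in> ?G"
    using extreme_point_of_face[OF G] by auto
  have eq: "?G = {x \<in> P. insert i S \<subseteq> tight UNIV U b x}"
    by (subst face_eq) (use tight_iff facet_of_imp_subset[OF facet_i] in auto)
  with \<open>v \<in> ?G\<close> have "insert i S \<subseteq> tight UNIV U b v"
    by blast
  with P.aff_dim_tight_face[of v "insert i S"] \<open>v extreme_point_of P\<close>
  have "int CARD('d) - int (card (insert i S)) \<le> aff_dim ?G"
    unfolding eq by (simp only: flip: P_eq)
  then have "aff_dim \<Delta> - 1 \<le> aff_dim ?G"
    using i(1) card_S aff_dim_face by simp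
  moreover have "?G face_of \<Delta>"
    using G face_of_imp_subset[OF face] by (auto intro: face_of_subset[of _ P])
  moreover from this have "aff_dim ?G < aff_dim \<Delta>"
    using i(1) face_of_imp_convex[OF face] by (intro face_of_aff_dim_lt) auto
  ultimately show "i \<in> face_rows facet \<Delta>"
    using i(2) by (simp add: face_rows_def facet_of_def)
qed

section \<open>Coordinates on the face\<close>

text \<open>On the face \<open>\<Delta>\<close> the coordinates in \<open>K\<close> are those of \<open>y0\<close>, so that \<open>\<Delta>\<close> is the image of its
  coordinate version under the affine map \<open>lift\<close>.\<close>

definition y0 :: "real ^ 'd" where
  "y0 = (\<chi> j. if j \<in> K then b (inv_into S e j) else 0)"

definition lift :: "real ^ 'd \<Rightarrow> real ^ 'd" where
  "lift z = T *v (y0 + z)"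

abbreviation W where "W \<equiv> face_matrix U T (-K)"

text \<open>The shift removes the contribution of the fixed coordinates \<open>y0\<close>, so slacks
  at \<open>z\<close> agree with those at \<open>lift z\<close>.\<close>

definition b' where "b' i = b i - (U ** T) $ i \<bullet> y0"

lemma inner_UT: "(U ** T) $ i \<bullet> y = U $ i \<bullet> (T *v y)"
proof -
  have "(U ** T) $ i = U $ i v* T"
    by (simp add: vec_eq_iff matrix_matrix_mult_def vector_matrix_mult_def mult.commute)
  then show ?thesis
    by (simp add: dot_lmul_matrix)
qed

lemma slack_lift:
  assumes "z \<in> coord_space (-K)"
  shows "W $ i \<bullet> z - b' i = U $ i \<bullet> lift z - b i"
  using assms by (simp add: face_matrix_def inner_coord_proj b'_def lift_def inner_add_right
      flip: inner_UT)

text \<open>In the coordinates given by \<open>T\<close>, row \<open>i\<close> reads off coordinate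
  \<open>e i\<close>, which is \<open>b i\<close> in \<open>y0\<close> and 0 in
  \<open>z\<close>.\<close>

lemma inner_lift_S:
  assumes "z \<in> coord_space (-K)" "i \<in> S"
  shows "U $ i \<bullet> lift z = b i"
proof -
  have "e i \<in> K" "inv_into S e (e i) = i"
    using bij_e assms by (auto simp: bij_betw_def)
  with assms show ?thesis
    by (simp add: lift_def axis_rows inner_axis' y0_def coord_space_def flip: inner_UT)
qed

lemma T_inv: "T *v (matrix_inv T *v x) = x" "matrix_inv T *v (T *v x) = x"
proof -
  have "T ** matrix_inv T = mat 1 \<and> matrix_inv T ** T = mat 1"
    using inv_T unfolding matrix_inv_def invertible_def by (rule someI_ex)
  then show "T *v (matrix_inv T *v x) = x" "matrix_inv T *v (T *v x) = x"
    by (simp_all add: matrix_vector_mul_assoc)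
qed

lemma lift_coord_proj:
  assumes "x \<in> \<Delta>"
  shows "lift (coord_proj (-K) (matrix_inv T *v x)) = x"
proof -
  have "(matrix_inv T *v x) $ j = y0 $ j" if "j \<in> K" for j
  proof -
    define i where "i = inv_into S e j"
    have i: "i \<in> S" "e i = j"
      using bij_e that unfolding i_def by (auto simp: bij_betw_def f_inv_into_f inv_into_into)
    have "(matrix_inv T *v x) $ j = U $ i \<bullet> x"
      using inner_UT[of i "matrix_inv T *v x"] i by (simp add: axis_rows inner_axis' T_inv)
    also have "\<dots> = b i"
      using assms i(1) by (auto simp: facet_eq)
    finally show ?thesis
      using that by (simp add: y0_def i_def)
  qed
  then have "y0 + coord_proj (-K) (matrix_inv T *v x) = matrix_inv T *v x"
    by (auto simp: vec_eq_iff coord_proj_def y0_def)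
  then show ?thesis
    by (simp add: lift_def T_inv)
qed

lemma coord_proj_lift:
  assumes "z \<in> coord_space (-K)"
  shows "coord_proj (-K) (matrix_inv T *v lift z) = z"
  using assms by (auto simp: lift_def T_inv vec_eq_iff coord_proj_def y0_def coord_space_def)

text \<open>The inequalities in \<open>S\<close> become equations on the image of
  \<open>lift\<close> and drop out. Those of facets disjoint from \<open>\<Delta>\<close> remain but
  are nowhere tight on \<open>D\<close>.\<close>

abbreviation D where "D \<equiv> halfspaces (-K) (-S) W b'"

lemma lift_in_face_iff:
  assumes "z \<in> coord_space (-K)"
  shows "lift z \<in> \<Delta> \<longleftrightarrow> z \<in> D"
proof -
  have "b' i \<le> W $ i \<bullet> z \<longleftrightarrow> b i \<le> U $ i \<bullet> lift z" for i
    using slack_lift[OF assms, of i] by linarith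
  moreover have "lift z \<in> \<Delta> \<longleftrightarrow> (\<forall>i. b i \<le> U $ i \<bullet> lift z)"
    by (subst face_eq, subst P_eq)
      (auto simp: halfspaces_def coord_space_def tight_def inner_lift_S[OF assms])
  ultimately show ?thesis
    using assms inner_lift_S[OF assms] by (force simp: halfspaces_def)
qed

lemma D_eq: "face_in_coords T (-K) \<Delta> = D"
proof (intro equalityI subsetI)
  fix z assume "z \<in> face_in_coords T (-K) \<Delta>"
  then obtain x where "x \<in> \<Delta>" "z = coord_proj (-K) (matrix_inv T *v x)"
    by (auto simp: face_in_coords_def)
  then show "z \<in> D"
    using lift_in_face_iff[of z] lift_coord_proj coord_proj_in by metis
next
  fix z assume z: "z \<in> D"
  then have "z \<in> coord_space (-K)"
    by (simp add: halfspaces_def)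
  with z show "z \<in> face_in_coords T (-K) \<Delta>"
    unfolding face_in_coords_def using lift_in_face_iff coord_proj_lift by (metis image_eqI)
qed

lemma lift_image: "lift ` D = \<Delta>"
proof (intro equalityI subsetI)
  fix x assume "x \<in> lift ` D"
  then obtain z where z: "z \<in> D" "x = lift z"
    by blast
  then have "z \<in> coord_space (-K)"
    by (simp add: halfspaces_def)
  with z show "x \<in> \<Delta>"
    by (simp add: lift_in_face_iff)
next
  fix x assume "x \<in> \<Delta>"
  then have "coord_proj (-K) (matrix_inv T *v x) \<in> D"
    by (auto simp: face_in_coords_def simp flip: D_eq)
  then show "x \<in> lift ` D"
    using lift_coord_proj[OF \<open>x \<in> \<Delta>\<close>] by (metis image_eqI)
qed

text \<open>Injective affine maps preserve faces, and the vertices of \<open>\<Delta>\<close> are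
  the vertices of \<open>P\<close> lying in it.\<close>

lemma extreme_point_lift:
  "z extreme_point_of D \<longleftrightarrow> lift z extreme_point_of P \<and> lift z \<in> \<Delta>"
proof -
  have lift: "lift ` X = (+) (T *v y0) ` (*v) T ` X" for X
    by (simp add: lift_def image_image matrix_vector_right_distrib)
  have "inj ((*v) T)"
    using T_inv(2) by (metis injI)
  then have "z extreme_point_of D \<longleftrightarrow> lift ` {z} face_of lift ` D"
    unfolding lift by (simp add: face_of_linear_image face_of_singleton del: image_insert)
  then show ?thesis
    using extreme_point_of_face[OF face] by (simp add: lift_image face_of_singleton)
qed

lemma bij_betw_vertices:
  "bij_betw lift {z. z extreme_point_of D} {v. v extreme_point_of P \<and> v \<in> \<Delta>}"
proof (rule bij_betw_byWitness[where f' = "\<lambda>x. coord_proj (-K) (matrix_inv T *v x)"])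
  show "\<forall>z\<in>{z. z extreme_point_of D}. coord_proj (-K) (matrix_inv T *v lift z) = z"
    by (simp add: coord_proj_lift extreme_point_of_def halfspaces_def)
  show "\<forall>x\<in>{v. v extreme_point_of P \<and> v \<in> \<Delta>}. lift (coord_proj (-K) (matrix_inv T *v x)) = x"
    by (simp add: lift_coord_proj)
  show "lift ` {z. z extreme_point_of D} \<subseteq> {v. v extreme_point_of P \<and> v \<in> \<Delta>}"
    by (auto simp: extreme_point_lift)
  show "(\<lambda>x. coord_proj (-K) (matrix_inv T *v x)) ` {v. v extreme_point_of P \<and> v \<in> \<Delta>}
      \<subseteq> {z. z extreme_point_of D}"
    by (auto simp: extreme_point_lift lift_coord_proj)
qed

lemma tight_lift:
  assumes "z \<in> coord_space (-K)"
  shows "tight (-S) W b' z = tight UNIV U b (lift z) - S"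
  using slack_lift[OF assms] by (auto simp: tight_def) (metis eq_iff_diff_eq_0)+

text \<open>Simplicity passes to the face: of the \<open>CARD('d)\<close> rows tight at a vertex,
  \<open>k\<close> belong to \<open>S\<close>, and the others are the tight rows of
  \<open>D\<close>.\<close>

sublocale D: simple_halfspaces "-K" "-S" W b'
proof
  fix i show "W $ i \<in> coord_space (-K)"
    by (simp add: face_matrix_def coord_proj_in)
next
  fix z assume z: "z extreme_point_of D"
  then have "lift z extreme_point_of P" "S \<subseteq> tight UNIV U b (lift z)"
    using extreme_point_lift face_eq by auto
  then have "card (tight UNIV U b (lift z) - S) = CARD('d) - k"
    by (simp add: card_Diff_subset card_tight_P card_S)
  moreover have "card (-K) = CARD('d) - k"
    using card_Diff_subset[of K UNIV] card_K by (simp add: Compl_eq_Diff_UNIV[symmetric])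
  moreover have "z \<in> coord_space (-K)"
    using z by (simp add: extreme_point_of_def halfspaces_def)
  ultimately show "card (tight (-S) W b' z) \<le> card (-K)"
    by (simp add: tight_lift)
qed

section \<open>Restriction of the adjoint and residue of the amplitude\<close>

lemma rows_P: "{i \<in> UNIV. \<exists>x\<in>P. U $ i \<bullet> x = b i} = UNIV"
proof -
  have "facet i \<noteq> {}" for i
    using facet_i by (simp add: facet_of_def)
  then show ?thesis
    by (auto simp: facet_eq)
qed

text \<open>The vertex sums know the rays of the fan as the attained inequalities. Under
  \<open>lift\<close> these correspond to the facets that meet \<open>\<Delta>\<close> without
  containing it.\<close>

lemma rows_D: "{i \<in> -S. \<exists>z\<in>D. W $ i \<bullet> z = b' i} = face_rows facet \<Delta>"
proof -
  have "W $ i \<bullet> z = b' i \<longleftrightarrow> U $ i \<bullet> lift z = b i" if "z \<in> D" for i z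
    using slack_lift[of z i] that by (auto simp: halfspaces_def)
  then have "(\<exists>z\<in>D. W $ i \<bullet> z = b' i) \<longleftrightarrow> (\<exists>x\<in>lift ` D. U $ i \<bullet> x = b i)" for i
    by auto
  also have "\<dots> i \<longleftrightarrow> facet i \<inter> \<Delta> \<noteq> {}" for i
    unfolding lift_image using face_of_imp_subset[OF face] facet_eq[of i] by blast
  finally have "(\<exists>z\<in>D. W $ i \<bullet> z = b' i) \<longleftrightarrow> facet i \<inter> \<Delta> \<noteq> {}" for i .
  then show ?thesis
    by (simp only: face_rows_eq Compl_iff)
qed

lemma restrict_Adj:
  "restrict_poly S (Adj UNIV (normal_fan UNIV P) UNIV U) =
     Const (inverse \<bar>det T\<bar>) * (\<Prod>Q | facet Q \<inter> \<Delta> = {}. Var Q) *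
     Adj (-K) (face_fan T (-K) \<Delta>) (face_rows facet \<Delta>) W"
proof -
  define g where "g R = Const (abs_minor UNIV U R) * (\<Prod>i\<in>UNIV - R. Var i)" for R
  define h where "h R = Const (abs_minor (-K) W R) * (\<Prod>i\<in>face_rows facet \<Delta> - R. Var i)" for R
  let ?E = "{v. v extreme_point_of P}" and ?c = "Const (inverse \<bar>det T\<bar>) * (\<Prod>Q | facet Q \<inter> \<Delta> = {}. Var Q)"
  have "Adj UNIV (normal_fan UNIV P) UNIV U = (\<Sum>v\<in>?E. g (tight UNIV U b v))"
    using P.sum_max_cones[of g] unfolding rows_P P_eq[symmetric] by (simp add: Adj_def g_def)
  then have "restrict_poly S (Adj UNIV (normal_fan UNIV P) UNIV U) =
      (\<Sum>v\<in>?E. restrict_poly S (g (tight UNIV U b v)))"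
    by (simp add: restrict_poly_sum)
  also have "\<dots> = (\<Sum>v\<in>?E. if v \<in> \<Delta> then g (tight UNIV U b v) else 0)"
  proof (rule sum.cong)
    fix v assume "v \<in> ?E"
    then have "v \<in> P"
      by (simp add: extreme_point_of_def)
    \<comment> \<open>The monomial of \<open>v\<close> avoids the variables in \<open>S\<close>
      exactly when every facet containing \<open>\<Delta>\<close> passes through
      \<open>v\<close>.\<close>
    then have "(UNIV - tight UNIV U b v) \<inter> S = {} \<longleftrightarrow> v \<in> \<Delta>"
      using face_eq by blast
    then show "restrict_poly S (g (tight UNIV U b v)) = (if v \<in> \<Delta> then g (tight UNIV U b v) else 0)"
      by (simp add: g_def restrict_poly_mult restrict_poly_Const restrict_poly_prod_Var)
  qed simp
  also have "\<dots> = (\<Sum>v | v extreme_point_of P \<and> v \<in> \<Delta>. g (tight UNIV U b v))"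
    using finite_polyhedron_extreme_points[OF polytope_imp_polyhedron[OF polytope_P]]
    by (simp add: sum.inter_filter[symmetric])
  also have "\<dots> = (\<Sum>z | z extreme_point_of D. g (tight UNIV U b (lift z)))"
    by (rule sum.reindex_bij_betw[OF bij_betw_vertices, symmetric])
  also have "\<dots> = (\<Sum>z | z extreme_point_of D. ?c * h (tight (-S) W b' z))"
  proof (rule sum.cong)
    fix z assume "z \<in> {z. z extreme_point_of D}"
    then have v: "lift z extreme_point_of P" "lift z \<in> \<Delta>" and z: "z \<in> coord_space (-K)"
      using extreme_point_lift[of z] by (auto simp: extreme_point_of_def[of z] halfspaces_def)
    let ?R = "tight UNIV U b (lift z)"
    have "S \<subseteq> ?R" "lift z \<in> P"
      using v face_eq by auto
    have "abs_minor UNIV U ?R * \<bar>det T\<bar> = abs_minor (-K) W (?R - S)"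
      by (rule abs_minor_block[OF bij_e]) (use axis_rows \<open>S \<subseteq> ?R\<close> card_tight_P[OF v(1)] in auto)
    moreover have "det T \<noteq> 0"
      using inv_T by (simp add: invertible_det_nz)
    ultimately have minor: "abs_minor UNIV U ?R = inverse \<bar>det T\<bar> * abs_minor (-K) W (?R - S)"
      by (simp add: field_simps)
    \<comment> \<open>A facet not through the vertex either misses \<open>\<Delta>\<close>, which
      gives the factor common to all vertices, or cuts out a facet of \<open>\<Delta>\<close> not
      through the vertex.\<close>
    have "UNIV - ?R = {Q. facet Q \<inter> \<Delta> = {}} \<union> (face_rows facet \<Delta> - (?R - S))"
      using \<open>S \<subseteq> ?R\<close> v(2) tight_iff[OF \<open>lift z \<in> P\<close>] by (auto simp: face_rows_eq)
    moreover have "{Q. facet Q \<inter> \<Delta> = {}} \<inter> (face_rows facet \<Delta> - (?R - S)) = {}"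
      by (auto simp: face_rows_eq)
    ultimately have "(\<Prod>i\<in>UNIV - ?R. Var i) = (\<Prod>Q | facet Q \<inter> \<Delta> = {}. Var Q) *
        (\<Prod>i\<in>face_rows facet \<Delta> - (?R - S). Var i :: 'n mpoly)"
      by (simp add: prod.union_disjoint)
    with minor show "g ?R = ?c * h (tight (-S) W b' z)"
      by (simp add: g_def h_def tight_lift[OF z] Const_mult ac_simps)
  qed simp
  also have "\<dots> = ?c * (\<Sum>z | z extreme_point_of D. h (tight (-S) W b' z))"
    by (simp add: sum_distrib_left)
  also have "(\<Sum>z | z extreme_point_of D. h (tight (-S) W b' z)) =
      Adj (-K) (face_fan T (-K) \<Delta>) (face_rows facet \<Delta>) W"
    using D.sum_max_cones[of h] unfolding rows_D by (simp add: Adj_def h_def face_fan_def D_eq)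
  finally show ?thesis .
qed

text \<open>Of the variables outside \<open>S\<close>, those of facets disjoint from
  \<open>\<Delta>\<close> cancel against the factor in the restricted adjoint; the others form the
  denominator of the amplitude of \<open>\<Delta>\<close>.\<close>

lemma res_Amp_face:
  "res S (Amp UNIV (normal_fan UNIV P) UNIV U) =
     to_fract (Const (inverse \<bar>det T\<bar>)) * Amp (-K) (face_fan T (-K) \<Delta>) (face_rows facet \<Delta>) W"
proof -
  have "- S = {Q. facet Q \<inter> \<Delta> = {}} \<union> face_rows facet \<Delta>"
    using nonempty by (auto simp: face_rows_eq)
  moreover have "{Q. facet Q \<inter> \<Delta> = {}} \<inter> face_rows facet \<Delta> = {}"
    by (auto simp: face_rows_eq)
  ultimately have "(\<Prod>i\<in>-S. Var i) =
      (\<Prod>Q | facet Q \<inter> \<Delta> = {}. Var Q) * (\<Prod>i\<in>face_rows facet \<Delta>. Var i :: 'n mpoly)"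
    by (simp only: prod.union_disjoint finite)
  then show ?thesis
    using prod_Var_neq_0[of "{Q. facet Q \<inter> \<Delta> = {}}"]
    by (simp add: res_Amp restrict_Adj Amp_eq_Adj_div[of "-K"])
qed

end


theorem lemma3p8:
  fixes U :: "real ^ 'd ^ ('n::{finite,linorder})"
    and P \<Delta> :: "(real ^ 'd) set"
    and facet :: "'n \<Rightarrow> (real ^ 'd) set"
    and T :: "real ^ 'd ^ 'd"
    and k :: nat
    and K :: "'d set"
    and e :: "'n \<Rightarrow> 'd"
  assumes "simple_polytope P"
    and "aff_dim P = int CARD('d)"
    and "bij_betw facet UNIV {F. F facet_of P}"
    and "is_ray_matrix P facet U"
    and "\<Delta> face_of P" and "\<Delta> \<noteq> {}"
    and "aff_dim \<Delta> = int CARD('d) - int k"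
    and "invertible T"
    and "card K = k"
    and "bij_betw e {Q. \<Delta> \<subseteq> facet Q} K"
    and "\<And>Q. \<Delta> \<subseteq> facet Q \<Longrightarrow> (U ** T) $ Q = axis (e Q) 1"
  shows "restrict_poly {Q. \<Delta> \<subseteq> facet Q} (Adj UNIV (normal_fan UNIV P) UNIV U) =
           Const (inverse \<bar>det T\<bar>) * (\<Prod>Q | facet Q \<inter> \<Delta> = {}. Var Q) *
           Adj (- K) (face_fan T (- K) \<Delta>) (face_rows facet \<Delta>) (face_matrix U T (- K))
       \<and> res {Q. \<Delta> \<subseteq> facet Q} (Amp UNIV (normal_fan UNIV P) UNIV U) =
           to_fract (Const (inverse \<bar>det T\<bar>)) *
           Amp (- K) (face_fan T (- K) \<Delta>) (face_rows facet \<Delta>) (face_matrix U T (- K))"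
proof -
  \<comment> \<open>Row \<open>i\<close> generates the normal cone of its facet, hence lies in it
    and gives a supporting inequality; its constants, chosen for all \<open>i\<close>, form
    \<open>b\<close>.\<close>
  have "\<exists>c. facet i = {x \<in> P. U $ i \<bullet> x = c} \<and> (\<forall>x\<in>P. c \<le> U $ i \<bullet> x)" for i
  proof (rule facet_inequality)
    show "convex P"
      using assms(1) by (simp add: simple_polytope_def polytope_imp_convex)
    show "facet i facet_of P"
      using assms(3) by (auto simp: bij_betw_def)
    show "U $ i \<noteq> 0"
      using assms(4) by (simp add: is_ray_matrix_def)
    show "U $ i \<in> normal_cone UNIV P (facet i)"
      using assms(4) hull_subset[of "{U $ i}" conic] by (auto simp: is_ray_matrix_def)
  qed fact
  from choice[OF allI, OF this] obtain b
    where b: "\<forall>i. facet i = {x \<in> P. U $ i \<bullet> x = b i} \<and> (\<forall>x\<in>P. b i \<le> U $ i \<bullet> x)"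
    by (rule exE)
  interpret simple_polytope_face U P \<Delta> facet T k K e b
  proof (rule simple_polytope_face.intro[OF assms(1-3) _ _ assms(5-11)])
    show "facet i = {x \<in> P. U $ i \<bullet> x = b i}" for i
      using spec[OF b, of i] by (rule conjunct1)
    show "b i \<le> U $ i \<bullet> x" if "x \<in> P" for i x
      using conjunct2[OF spec[OF b, of i]] that by (rule bspec)
  qed
  show ?thesis
    using restrict_Adj res_Amp_face by (rule conjI)
qed

end
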